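(* Let $n\ge 1$, let $Q=\{Q_1,\ldots,Q_m\}$ be a partition of $\{1,\ldots,n\}$ into $m$ (nonempty) parts, let $F_m=\langle x_1,\ldots,x_m\rangle$ be the free group on $x_1,\ldots,x_m$, and let $t=(t_1,\ldots,t_n)\in F_m^n$ be the tuple with $t_i=x_s$ if and only if $i\in Q_s$. Then the orbit of $t$ under the Hurwitz action of $B_n$ on $F_m^n$ is the set of those elements $(g_1,\ldots,g_n)$ of $$\bigcup_{\tau\in S_n} C(t_{\tau(1)})\times\cdots\times C(t_{\tau(n)})$$ whose product satisfies $g_1\cdots g_n=t_1\cdots t_n$, where $C(x)$ denotes the conjugacy class of $x$ in $F_m$.
   Context: $B_n$ is the braid group on $n$ strands with standard generators $\sigma_1,\ldots,\sigma_{n-1}$, and $S_n$ is the symmetric group. For a group $G$, the Hurwitz action of $B_n$ on $G^n$ is the left action determined by $$\sigma_i(g_1,\ldots,g_i,g_{i+1},\ldots,g_n)=(g_1,\ldots,g_{i+1},\,g_{i+1}^{-1}g_ig_{i+1},\ldots,g_n)$$ (the entries $g_i,g_{i+1}$ in positions $i,i+1$ are replaced by $g_{i+1},\ g_{i+1}^{-1}g_ig_{i+1}$, the others are unchanged). *)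

theory Defs
  imports
    "HOL-Algebra.Group_Action"
    "HOL-Algebra.Generated_Groups"
    "HOL-Combinatorics.Permutations"
    "HOL-Library.Disjoint_Sets"
begin

section \<open>Free groups\<close>

text \<open>
  The free group on \<open>X\<close> is the set of reduced words in the letters
  \<open>(x, True)\<close> (standing for \<open>x\<close>) and \<open>(x, False)\<close> (standing for \<open>x\<close> inverse),
  multiplied by concatenation followed by free reduction.
\<close>

type_synonym 'a letter = "'a \<times> bool"

definition flip :: "'a letter \<Rightarrow> 'a letter"
  where "flip a = (fst a, \<not> snd a)"

definition reduced :: "'a letter list \<Rightarrow> bool"
  where "reduced w \<longleftrightarrow> successively (\<lambda>a b. b \<noteq> flip a) w"

definition cancel_cons :: "'a letter \<Rightarrow> 'a letter list \<Rightarrow> 'a letter list"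
  where "cancel_cons a w =
    (case w of [] \<Rightarrow> [a] | b # v \<Rightarrow> if b = flip a then v else a # w)"

definition free_group :: "'a set \<Rightarrow> 'a letter list monoid"
  where "free_group X =
    \<lparr>carrier = {w. set w \<subseteq> X \<times> UNIV \<and> reduced w},
     monoid.mult = \<lambda>u v. foldr cancel_cons u v,
     one = []\<rparr>"

definition free_gen :: "'a \<Rightarrow> 'a letter list"
  where "free_gen x = [(x, True)]"

definition free_group_lift :: "('b, 'c) monoid_scheme \<Rightarrow> ('a \<Rightarrow> 'b) \<Rightarrow> 'a letter list \<Rightarrow> 'b"
  where "free_group_lift H f w =
    foldr (\<lambda>a h. (if snd a then f (fst a) else inv\<^bsub>H\<^esub> (f (fst a))) \<otimes>\<^bsub>H\<^esub> h) w \<one>\<^bsub>H\<^esub>"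

lemma flip_flip [simp]: "flip (flip a) = a"
  by (simp add: flip_def)

lemma flip_eq_iff [simp]: "flip a = flip b \<longleftrightarrow> a = b"
  by (metis flip_flip)

lemma fst_flip [simp]: "fst (flip a) = fst a"
  by (simp add: flip_def)

lemma reduced_Nil [simp]: "reduced []"
  by (simp add: reduced_def)

lemma reduced_single [simp]: "reduced [a]"
  by (simp add: reduced_def)

lemma reduced_Cons:
  "reduced (a # w) \<longleftrightarrow> reduced w \<and> (w = [] \<or> hd w \<noteq> flip a)"
  by (auto simp: reduced_def successively_Cons)

lemma cancel_cons_reduced: "reduced w \<Longrightarrow> reduced (cancel_cons a w)"
  by (auto simp: cancel_cons_def reduced_Cons split: list.splits)

lemma cancel_cons_flip: "reduced w \<Longrightarrow> cancel_cons a (cancel_cons (flip a) w) = w"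
  by (cases w) (auto simp: cancel_cons_def reduced_Cons split: list.splits)

lemma cancel_cons_id: "reduced (a # w) \<Longrightarrow> cancel_cons a w = a # w"
  by (cases w) (auto simp: cancel_cons_def reduced_Cons)

lemma foldr_cancel_cons_reduced: "reduced v \<Longrightarrow> reduced (foldr cancel_cons u v)"
  by (induction u) (auto simp: cancel_cons_reduced)

lemma foldr_cancel_cons_Cons:
  assumes "reduced w"
  shows "foldr cancel_cons (cancel_cons a u) w = cancel_cons a (foldr cancel_cons u w)"
proof (cases "\<exists>v. u = flip a # v")
  case True
  then obtain v where v: "u = flip a # v" by blast
  have "cancel_cons a u = v" by (simp add: v cancel_cons_def)
  then show ?thesis
    using cancel_cons_flip[OF foldr_cancel_cons_reduced[OF assms]] by (simp add: v)
next
  case False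
  then have "cancel_cons a u = a # u"
    by (auto simp: cancel_cons_def split: list.splits)
  then show ?thesis by simp
qed

lemma foldr_cancel_cons_assoc:
  "reduced w \<Longrightarrow>
    foldr cancel_cons (foldr cancel_cons u v) w = foldr cancel_cons u (foldr cancel_cons v w)"
  by (induction u) (auto simp: foldr_cancel_cons_Cons)

lemma foldr_cancel_cons_Nil: "reduced w \<Longrightarrow> foldr cancel_cons w [] = w"
  by (induction w) (auto simp: cancel_cons_id reduced_Cons)

lemma foldr_cancel_cons_inverse: "foldr cancel_cons (rev (map flip w)) w = []"
  by (induction w) (auto simp: cancel_cons_def)

lemma set_cancel_cons: "set (cancel_cons a w) \<subseteq> insert a (set w)"
  by (auto simp: cancel_cons_def split: list.splits if_splits)

lemma set_foldr_cancel_cons: "set (foldr cancel_cons u v) \<subseteq> set u \<union> set v"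
proof (induction u)
  case (Cons a u)
  then show ?case
    using set_cancel_cons[of a "foldr cancel_cons u v"] by auto
qed simp

lemma reduced_inverse: "reduced w \<Longrightarrow> reduced (rev (map flip w))"
  unfolding reduced_def successively_rev successively_map
  by (erule successively_mono) (metis flip_flip)

lemma group_free_group: "group (free_group X)"
proof (rule groupI)
  fix u v assume "u \<in> carrier (free_group X)" "v \<in> carrier (free_group X)"
  then show "u \<otimes>\<^bsub>free_group X\<^esub> v \<in> carrier (free_group X)"
    using set_foldr_cancel_cons[of u v]
    by (auto simp: free_group_def foldr_cancel_cons_reduced)
next
  fix u assume u: "u \<in> carrier (free_group X)"
  then have "rev (map flip u) \<in> carrier (free_group X)"
    by (force simp: free_group_def reduced_inverse flip_def)
  moreover have "rev (map flip u) \<otimes>\<^bsub>free_group X\<^esub> u = \<one>\<^bsub>free_group X\<^esub>"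
    by (simp add: free_group_def foldr_cancel_cons_inverse)
  ultimately show "\<exists>v\<in>carrier (free_group X). v \<otimes>\<^bsub>free_group X\<^esub> u = \<one>\<^bsub>free_group X\<^esub>"
    by blast
qed (auto simp: free_group_def foldr_cancel_cons_assoc)

lemma free_gen_closed: "x \<in> X \<Longrightarrow> free_gen x \<in> carrier (free_group X)"
  by (simp add: free_gen_def free_group_def)

lemma (in group) free_group_lift_closed:
  assumes "f \<in> X \<rightarrow> carrier G" "set w \<subseteq> X \<times> UNIV"
  shows "free_group_lift G f w \<in> carrier G"
  using assms(2)
proof (induction w)
  case (Cons a w)
  then show ?case using assms(1) by (auto simp: free_group_lift_def Pi_iff)
qed (simp add: free_group_lift_def)

lemma (in group) free_group_lift_cancel_cons:
  assumes f: "f \<in> X \<rightarrow> carrier G" and a: "fst a \<in> X" and w: "set w \<subseteq> X \<times> UNIV"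
  shows "free_group_lift G f (cancel_cons a w) = free_group_lift G f (a # w)"
proof (cases "\<exists>v. w = flip a # v")
  case True
  then obtain v where v: "w = flip a # v" by blast
  then have c: "free_group_lift G f v \<in> carrier G" "f (fst a) \<in> carrier G"
    using free_group_lift_closed[OF f, of v] w f a by (auto simp: Pi_iff)
  have "free_group_lift G f (a # w) = free_group_lift G f v"
    using c by (auto simp: v free_group_lift_def flip_def m_assoc[symmetric])
  then show ?thesis by (simp add: v cancel_cons_def)
next
  case False
  then have "cancel_cons a w = a # w"
    by (auto simp: cancel_cons_def split: list.splits)
  then show ?thesis by simp
qed

lemma (in group) free_group_lift_hom:
  assumes f: "f \<in> X \<rightarrow> carrier G"
  shows "free_group_lift G f \<in> hom (free_group X) G"
proof (rule homI)
  fix u assume "u \<in> carrier (free_group X)"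
  then show "free_group_lift G f u \<in> carrier G"
    using free_group_lift_closed[OF f] by (auto simp: free_group_def)
next
  fix u v assume uv: "u \<in> carrier (free_group X)" "v \<in> carrier (free_group X)"
  then have u: "set u \<subseteq> X \<times> UNIV" and v: "set v \<subseteq> X \<times> UNIV"
    by (auto simp: free_group_def)
  from u have "free_group_lift G f (foldr cancel_cons u v) =
    free_group_lift G f u \<otimes> free_group_lift G f v"
  proof (induction u)
    case Nil
    then show ?case using free_group_lift_closed[OF f v] by (simp add: free_group_lift_def)
  next
    case (Cons a u)
    have s: "set (foldr cancel_cons u v) \<subseteq> X \<times> UNIV"
      using set_foldr_cancel_cons[of u v] v Cons.prems by auto
    have a: "fst a \<in> X" and u: "set u \<subseteq> X \<times> UNIV" using Cons.prems by auto
    then have fa: "f (fst a) \<in> carrier G" using f by auto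
    have "free_group_lift G f (foldr cancel_cons (a # u) v) =
      free_group_lift G f (a # foldr cancel_cons u v)"
      using free_group_lift_cancel_cons[OF f a s] by simp
    also have "\<dots> = (if snd a then f (fst a) else inv (f (fst a))) \<otimes>
      free_group_lift G f (foldr cancel_cons u v)"
      by (simp add: free_group_lift_def)
    also have "\<dots> = (if snd a then f (fst a) else inv (f (fst a))) \<otimes>
      (free_group_lift G f u \<otimes> free_group_lift G f v)"
      using Cons.IH u by simp
    also have "\<dots> = (if snd a then f (fst a) else inv (f (fst a))) \<otimes>
      free_group_lift G f u \<otimes> free_group_lift G f v"
      using fa free_group_lift_closed[OF f u] free_group_lift_closed[OF f v]
      by (simp add: m_assoc)
    also have "\<dots> = free_group_lift G f (a # u) \<otimes> free_group_lift G f v"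
      by (simp add: free_group_lift_def)
    finally show ?case .
  qed
  then show "free_group_lift G f (u \<otimes>\<^bsub>free_group X\<^esub> v) =
    free_group_lift G f u \<otimes> free_group_lift G f v"
    by (simp add: free_group_def)
qed

lemma (in group) free_group_lift_gen:
  "f x \<in> carrier G \<Longrightarrow> free_group_lift G f (free_gen x) = f x"
  by (simp add: free_group_lift_def free_gen_def)


section \<open>Group presentations and the braid group\<close>

definition normal_closure :: "('a, 'b) monoid_scheme \<Rightarrow> 'a set \<Rightarrow> 'a set"
  where "normal_closure G R =
    generate G {g \<otimes>\<^bsub>G\<^esub> r \<otimes>\<^bsub>G\<^esub> inv\<^bsub>G\<^esub> g | g r. g \<in> carrier G \<and> r \<in> R}"

definition presented_group :: "'a set \<Rightarrow> 'a letter list set \<Rightarrow> 'a letter list set monoid"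
  where "presented_group X R = free_group X Mod normal_closure (free_group X) R"

definition presented_gen :: "'a set \<Rightarrow> 'a letter list set \<Rightarrow> 'a \<Rightarrow> 'a letter list set"
  where "presented_gen X R x = normal_closure (free_group X) R #>\<^bsub>free_group X\<^esub> free_gen x"

text \<open>
  Artin's presentation: the generators are indexed by \<open>{1..<n}\<close>, and a relation
  \<open>u = v\<close> is encoded by the relator \<open>u \<otimes> inv v\<close>.
\<close>

definition braid_relators :: "nat \<Rightarrow> nat letter list set"
  where "braid_relators n =
    (let F = free_group {1..<n}; s = free_gen in
      {s i \<otimes>\<^bsub>F\<^esub> s (i + 1) \<otimes>\<^bsub>F\<^esub> s i \<otimes>\<^bsub>F\<^esub> inv\<^bsub>F\<^esub> (s (i + 1) \<otimes>\<^bsub>F\<^esub> s i \<otimes>\<^bsub>F\<^esub> s (i + 1))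
        | i. i \<in> {1..<n} \<and> i + 1 \<in> {1..<n}} \<union>
      {s i \<otimes>\<^bsub>F\<^esub> s j \<otimes>\<^bsub>F\<^esub> inv\<^bsub>F\<^esub> (s j \<otimes>\<^bsub>F\<^esub> s i)
        | i j. i \<in> {1..<n} \<and> j \<in> {1..<n} \<and> i + 2 \<le> j})"

definition braid_group :: "nat \<Rightarrow> nat letter list set monoid"
  where "braid_group n = presented_group {1..<n} (braid_relators n)"

definition braid_gen :: "nat \<Rightarrow> nat \<Rightarrow> nat letter list set"
  where "braid_gen n = presented_gen {1..<n} (braid_relators n)"

lemma (in group) normal_closure_normal:
  assumes "R \<subseteq> carrier G"
  shows "normal_closure G R \<lhd> G"
  unfolding normal_closure_def
proof (rule normal_generateI)
  show "{g \<otimes> r \<otimes> inv g | g r. g \<in> carrier G \<and> r \<in> R} \<subseteq> carrier G"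
    using assms by auto
next
  fix h k assume "h \<in> {g \<otimes> r \<otimes> inv g | g r. g \<in> carrier G \<and> r \<in> R}" and k: "k \<in> carrier G"
  then obtain g r where h: "h = g \<otimes> r \<otimes> inv g" and g: "g \<in> carrier G" and r: "r \<in> R"
    by blast
  have "k \<otimes> h \<otimes> inv k = (k \<otimes> g) \<otimes> r \<otimes> inv (k \<otimes> g)"
    using g k r assms by (auto simp: h m_assoc inv_mult_group)
  then show "k \<otimes> h \<otimes> inv k \<in> {g \<otimes> r \<otimes> inv g | g r. g \<in> carrier G \<and> r \<in> R}"
    using g k r by blast
qed

lemma (in group_hom) normal_closure_le_kernel:
  assumes "R \<subseteq> kernel G H h"
  shows "normal_closure G R \<subseteq> kernel G H h"
  unfolding normal_closure_def
proof (rule G.generate_subgroup_incl[OF _ subgroup_kernel])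
  show "{g \<otimes>\<^bsub>G\<^esub> r \<otimes>\<^bsub>G\<^esub> inv\<^bsub>G\<^esub> g | g r. g \<in> carrier G \<and> r \<in> R} \<subseteq> kernel G H h"
    using assms by (force simp: kernel_def)
qed

lemma braid_relators_subset: "braid_relators n \<subseteq> carrier (free_group {1..<n})"
proof -
  interpret group "free_group {1..<n}" by (rule group_free_group)
  note gen = free_gen_closed[of _ "{1..<n}"]
  show ?thesis
    unfolding braid_relators_def Let_def
    by (intro Un_least subsetI; clarify; intro m_closed inv_closed gen; assumption)
qed

lemma group_braid_group: "group (braid_group n)"
  unfolding braid_group_def presented_group_def
  by (intro normal.factorgroup_is_group group.normal_closure_normal group_free_group
      braid_relators_subset)


section \<open>The Hurwitz action\<close>

text \<open>The power \<open>G^n\<close> is \<open>{1..n} \<rightarrow>\<^sub>E carrier G\<close>.\<close>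

definition hurwitz_move :: "('a, 'b) monoid_scheme \<Rightarrow> nat \<Rightarrow> nat \<Rightarrow> (nat \<Rightarrow> 'a) \<Rightarrow> nat \<Rightarrow> 'a"
  where "hurwitz_move G n i =
    (\<lambda>g \<in> {1..n} \<rightarrow>\<^sub>E carrier G.
      g(i := g (i + 1), i + 1 := inv\<^bsub>G\<^esub> (g (i + 1)) \<otimes>\<^bsub>G\<^esub> g i \<otimes>\<^bsub>G\<^esub> g (i + 1)))"

text \<open>
  The homomorphism from the free group on the standard generators to the bijections of \<open>G^n\<close>
  is constant on the cosets that make up the braid group; the action of a braid is its value on
  that coset. That this is well defined is \<open>hurwitz_action_coset\<close> below, and
  \<open>group_action_hurwitz\<close> and \<open>hurwitz_action_gen\<close> say that it is the left action
  prescribed on the generators by \<open>hurwitz_move\<close>.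
\<close>

definition hurwitz_action ::
    "('a, 'b) monoid_scheme \<Rightarrow> nat \<Rightarrow> nat letter list set \<Rightarrow> (nat \<Rightarrow> 'a) \<Rightarrow> nat \<Rightarrow> 'a"
  where "hurwitz_action G n b =
    the_elem (free_group_lift (BijGroup ({1..n} \<rightarrow>\<^sub>E carrier G)) (hurwitz_move G n) ` b)"

definition tuple_prod :: "('a, 'b) monoid_scheme \<Rightarrow> nat \<Rightarrow> (nat \<Rightarrow> 'a) \<Rightarrow> 'a"
  where "tuple_prod G n g = foldr (\<otimes>\<^bsub>G\<^esub>) (map g [1..<n + 1]) \<one>\<^bsub>G\<^esub>"

definition conjugacy_class :: "('a, 'b) monoid_scheme \<Rightarrow> 'a \<Rightarrow> 'a set"
  where "conjugacy_class G x = {h \<otimes>\<^bsub>G\<^esub> x \<otimes>\<^bsub>G\<^esub> inv\<^bsub>G\<^esub> h | h. h \<in> carrier G}"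

context group
begin

lemma inv_cancel_left:
  "x \<in> carrier G \<Longrightarrow> y \<in> carrier G \<Longrightarrow> inv x \<otimes> (x \<otimes> y) = y"
  "x \<in> carrier G \<Longrightarrow> y \<in> carrier G \<Longrightarrow> x \<otimes> (inv x \<otimes> y) = y"
  by (simp_all add: m_assoc[symmetric])

lemma PiE_entry: "g \<in> {1..n} \<rightarrow>\<^sub>E carrier G \<Longrightarrow> 1 \<le> k \<Longrightarrow> k \<le> n \<Longrightarrow> g k \<in> carrier G"
  by (auto simp: PiE_def Pi_iff)

lemma hurwitz_move_closed:
  assumes "i \<in> {1..<n}" "g \<in> {1..n} \<rightarrow>\<^sub>E carrier G"
  shows "hurwitz_move G n i g \<in> {1..n} \<rightarrow>\<^sub>E carrier G"
  using assms by (auto simp: hurwitz_move_def PiE_def Pi_iff extensional_def)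

lemma hurwitz_move_Bij:
  assumes i: "i \<in> {1..<n}"
  shows "hurwitz_move G n i \<in> Bij ({1..n} \<rightarrow>\<^sub>E carrier G)"
proof -
  define S where "S = {1..n} \<rightarrow>\<^sub>E carrier G"
  define h where "h = (\<lambda>g::nat \<Rightarrow> 'a. g(i := g i \<otimes> g (i + 1) \<otimes> inv (g i), i + 1 := g i))"
  have hS: "h g \<in> S" if "g \<in> S" for g
    using that i by (auto simp: h_def S_def PiE_def Pi_iff extensional_def)
  have entries: "g i \<in> carrier G" "g (i + 1) \<in> carrier G" if "g \<in> S" for g
    using that i PiE_entry unfolding S_def by auto
  have 1: "h (hurwitz_move G n i g) = g" if g: "g \<in> S" for g
    using g entries[OF g] by (auto simp: fun_eq_iff h_def hurwitz_move_def S_def m_assoc inv_cancel_left)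
  have 2: "hurwitz_move G n i (h g) = g" if g: "g \<in> S" for g
    using hS[OF g] entries[OF g]
    by (auto simp: fun_eq_iff h_def hurwitz_move_def S_def m_assoc inv_cancel_left)
  have "bij_betw (hurwitz_move G n i) S S"
  proof (rule bij_betw_byWitness[where f' = h])
    show "hurwitz_move G n i ` S \<subseteq> S"
      using hurwitz_move_closed[OF i] unfolding S_def by blast
    show "h ` S \<subseteq> S" using hS by blast
  qed (use 1 2 in blast)+
  then show ?thesis
    by (auto simp: Bij_def S_def hurwitz_move_def)
qed

lemma hurwitz_lift_relator:
  assumes "r \<in> braid_relators n"
  shows "free_group_lift (BijGroup ({1..n} \<rightarrow>\<^sub>E carrier G)) (hurwitz_move G n) r =
    \<one>\<^bsub>BijGroup ({1..n} \<rightarrow>\<^sub>E carrier G)\<^esub>"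
proof -
  define S where "S = {1..n} \<rightarrow>\<^sub>E carrier G"
  define F where "F = free_group {1..<n}"
  define m where "m = hurwitz_move G n"
  define L where "L = free_group_lift (BijGroup S) m"
  interpret B: group "BijGroup S" by (rule group_BijGroup)
  interpret F: group F unfolding F_def by (rule group_free_group)
  have mB: "m i \<in> Bij S" if "i \<in> {1..<n}" for i
    using hurwitz_move_Bij[OF that] by (simp add: m_def S_def)
  have cB: "carrier (BijGroup S) = Bij S" by (simp add: BijGroup_def)
  have mC: "m i \<in> carrier (BijGroup S)" if "i \<in> {1..<n}" for i
    using mB[OF that] cB by simp
  have mult: "p \<otimes>\<^bsub>BijGroup S\<^esub> q = compose S p q" if "p \<in> Bij S" "q \<in> Bij S" for p q
    using that by (simp add: BijGroup_def)
  have "L \<in> hom F (BijGroup S)"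
    unfolding L_def F_def using mB cB by (intro B.free_group_lift_hom) auto
  then interpret L: group_hom F "BijGroup S" L
    by unfold_locales
  have gen: "L (free_gen i) = m i" if "i \<in> {1..<n}" for i
    unfolding L_def using mB[OF that] cB by (intro B.free_group_lift_gen) auto
  have gF: "free_gen i \<in> carrier F" if "i \<in> {1..<n}" for i
    unfolding F_def using that by (rule free_gen_closed)
  have entry: "g k \<in> carrier G" if "g \<in> S" "1 \<le> k" "k \<le> n" for g k
    using that PiE_entry unfolding S_def by auto
  have mS: "m i g \<in> S" if "i \<in> {1..<n}" "g \<in> S" for i g
    using hurwitz_move_closed that by (simp add: m_def S_def)
  have m_app: "m i g = g(i := g (i + 1), i + 1 := inv (g (i + 1)) \<otimes> g i \<otimes> g (i + 1))"
    if "g \<in> S" for i g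
    using that by (simp add: m_def S_def hurwitz_move_def)
  have braid: "m i \<otimes>\<^bsub>BijGroup S\<^esub> m (i + 1) \<otimes>\<^bsub>BijGroup S\<^esub> m i =
      m (i + 1) \<otimes>\<^bsub>BijGroup S\<^esub> m i \<otimes>\<^bsub>BijGroup S\<^esub> m (i + 1)"
    if i: "i \<in> {1..<n}" "i + 1 \<in> {1..<n}" for i
  proof -
    have "m i (m (i + 1) (m i g)) = m (i + 1) (m i (m (i + 1) g))" if g: "g \<in> S" for g
    proof -
      have c: "g i \<in> carrier G" "g (Suc i) \<in> carrier G" "g (Suc (Suc i)) \<in> carrier G"
        using entry[OF g] i by auto
      have S: "m i g \<in> S" "m (i + 1) g \<in> S" "m (i + 1) (m i g) \<in> S" "m i (m (i + 1) g) \<in> S"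
        using mS i g by auto
      show ?thesis
        unfolding m_app[OF S(3)] m_app[OF S(4)]
        unfolding m_app[OF S(1)] m_app[OF S(2)]
        unfolding m_app[OF g]
        using c by (auto simp: fun_eq_iff m_assoc inv_mult_group inv_cancel_left)
    qed
    then have "compose S (compose S (m i) (m (i + 1))) (m i) =
        compose S (compose S (m (i + 1)) (m i)) (m (i + 1))"
      using mS[OF i(1)] mS[OF i(2)] by (auto simp: compose_def restrict_def)
    then show ?thesis
      using mB[OF i(1)] mB[OF i(2)] by (simp add: mult compose_Bij)
  qed
  have comm: "m i \<otimes>\<^bsub>BijGroup S\<^esub> m j = m j \<otimes>\<^bsub>BijGroup S\<^esub> m i"
    if i: "i \<in> {1..<n}" "j \<in> {1..<n}" "i + 2 \<le> j" for i j
  proof -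
    have "m i (m j g) = m j (m i g)" if g: "g \<in> S" for g
    proof -
      have S: "m i g \<in> S" "m j g \<in> S" using mS i g by auto
      show ?thesis
        unfolding m_app[OF S(1)] m_app[OF S(2)]
        unfolding m_app[OF g]
        using i by (auto simp: fun_eq_iff)
    qed
    then show ?thesis
      using mB i by (auto simp: mult compose_def fun_eq_iff restrict_def)
  qed
  have "L r = \<one>\<^bsub>BijGroup S\<^esub>"
  proof -
    consider i where "i \<in> {1..<n}" "i + 1 \<in> {1..<n}"
        "r = free_gen i \<otimes>\<^bsub>F\<^esub> free_gen (i + 1) \<otimes>\<^bsub>F\<^esub> free_gen i \<otimes>\<^bsub>F\<^esub>
          inv\<^bsub>F\<^esub> (free_gen (i + 1) \<otimes>\<^bsub>F\<^esub> free_gen i \<otimes>\<^bsub>F\<^esub> free_gen (i + 1))"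
      | i j where "i \<in> {1..<n}" "j \<in> {1..<n}" "i + 2 \<le> j"
        "r = free_gen i \<otimes>\<^bsub>F\<^esub> free_gen j \<otimes>\<^bsub>F\<^esub> inv\<^bsub>F\<^esub> (free_gen j \<otimes>\<^bsub>F\<^esub> free_gen i)"
      using assms unfolding braid_relators_def Let_def F_def by blast
    then show ?thesis
    proof cases
      case 1
      then show ?thesis
        using gF gen mC braid[of i]
        by (simp del: atLeastLessThan_iff Suc_eq_plus1 add_Suc_right)
    next
      case 2
      then show ?thesis
        using gF gen mC comm[of i j]
        by (simp del: atLeastLessThan_iff)
    qed
  qed
  then show ?thesis by (simp add: L_def S_def m_def)
qed

lemma hurwitz_lift_group_hom:
  "group_hom (free_group {1..<n}) (BijGroup ({1..n} \<rightarrow>\<^sub>E carrier G))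
    (free_group_lift (BijGroup ({1..n} \<rightarrow>\<^sub>E carrier G)) (hurwitz_move G n))"
  unfolding group_hom_def group_hom_axioms_def
  using hurwitz_move_Bij group_BijGroup group_free_group
  by (auto simp: BijGroup_def intro!: group.free_group_lift_hom)

lemma hurwitz_action_coset:
  assumes w: "w \<in> carrier (free_group {1..<n})"
  shows "hurwitz_action G n
      (normal_closure (free_group {1..<n}) (braid_relators n) #>\<^bsub>free_group {1..<n}\<^esub> w) =
    free_group_lift (BijGroup ({1..n} \<rightarrow>\<^sub>E carrier G)) (hurwitz_move G n) w"
proof -
  define F where "F = free_group {1..<n}"
  define H where "H = BijGroup ({1..n} \<rightarrow>\<^sub>E carrier G)"
  define L where "L = free_group_lift H (hurwitz_move G n)"
  define N where "N = normal_closure F (braid_relators n)"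
  interpret L: group_hom F H L
    unfolding F_def H_def L_def by (rule hurwitz_lift_group_hom)
  have "braid_relators n \<subseteq> kernel F H L"
    using braid_relators_subset hurwitz_lift_relator
    by (auto simp: kernel_def F_def H_def L_def)
  then have N: "N \<subseteq> kernel F H L"
    unfolding N_def by (rule L.normal_closure_le_kernel)
  have "N \<lhd> F"
    unfolding N_def F_def
    by (intro group.normal_closure_normal group_free_group braid_relators_subset)
  then interpret N: normal N F .
  have "w \<in> N #>\<^bsub>F\<^esub> w"
    using w L.G.rcos_self N.subgroup_axioms by (simp add: F_def)
  moreover have "L v = L w" if "v \<in> N #>\<^bsub>F\<^esub> w" for v
  proof -
    have wF: "w \<in> carrier F" using w by (simp add: F_def)
    from that obtain x where "x \<in> N" "v = x \<otimes>\<^bsub>F\<^esub> w"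
      unfolding r_coset_def by blast
    then show ?thesis
      using N wF by (auto simp: kernel_def)
  qed
  ultimately have "L ` (N #>\<^bsub>F\<^esub> w) = {L w}" by blast
  then show ?thesis
    by (simp add: hurwitz_action_def L_def N_def F_def H_def)
qed

lemma group_action_hurwitz:
  "group_action (braid_group n) ({1..n} \<rightarrow>\<^sub>E carrier G) (hurwitz_action G n)"
proof -
  define F where "F = free_group {1..<n}"
  define H where "H = BijGroup ({1..n} \<rightarrow>\<^sub>E carrier G)"
  define L where "L = free_group_lift H (hurwitz_move G n)"
  define N where "N = normal_closure F (braid_relators n)"
  interpret L: group_hom F H L
    unfolding F_def H_def L_def by (rule hurwitz_lift_group_hom)
  have "N \<lhd> F"
    unfolding N_def F_def
    by (intro group.normal_closure_normal group_free_group braid_relators_subset)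
  then interpret N: normal N F .
  have act: "hurwitz_action G n (N #>\<^bsub>F\<^esub> w) = L w" if "w \<in> carrier F" for w
    using hurwitz_action_coset that by (simp add: F_def N_def L_def H_def)
  have B: "braid_group n = F Mod N"
    by (simp add: braid_group_def presented_group_def F_def N_def)
  have "hurwitz_action G n \<in> hom (F Mod N) H"
  proof (rule homI)
    fix b assume "b \<in> carrier (F Mod N)"
    then show "hurwitz_action G n b \<in> carrier H"
      by (auto simp: carrier_FactGroup act)
  next
    fix b c assume "b \<in> carrier (F Mod N)" "c \<in> carrier (F Mod N)"
    then show "hurwitz_action G n (b \<otimes>\<^bsub>F Mod N\<^esub> c) =
      hurwitz_action G n b \<otimes>\<^bsub>H\<^esub> hurwitz_action G n c"
      by (auto simp: carrier_FactGroup act N.rcos_sum)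
  qed
  then show ?thesis
    using group_braid_group[of n] L.H.is_group
    by (simp add: group_action_def group_hom_def group_hom_axioms_def B H_def)
qed

lemma hurwitz_action_gen:
  assumes "i \<in> {1..<n}"
  shows "hurwitz_action G n (braid_gen n i) = hurwitz_move G n i"
proof -
  interpret B: group "BijGroup ({1..n} \<rightarrow>\<^sub>E carrier G)" by (rule group_BijGroup)
  have "hurwitz_move G n i \<in> carrier (BijGroup ({1..n} \<rightarrow>\<^sub>E carrier G))"
    using hurwitz_move_Bij[OF assms] by (simp add: BijGroup_def)
  then show ?thesis
    unfolding braid_gen_def presented_gen_def hurwitz_action_coset[OF free_gen_closed[OF assms]]
    by (rule B.free_group_lift_gen)
qed

end

end

theory Submission
  imports Defs
begin

text \<open>
  Write every entry of a tuple as \<open>w\<^sub>i\<inverse> x\<^sub>i w\<^sub>i\<close> with \<open>x\<^sub>i\<close> a generator and argue by descent on the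
  total length of the \<open>w\<^sub>i\<close>, as in Artin's characterisation of braid automorphisms. If in the
  product of two neighbouring entries the cancellation reaches the central letter of one of them,
  conjugating the longer entry by the shorter one is a Hurwitz move (or the inverse of one) that
  decreases the total length. Otherwise all central letters survive in the product; as this is a
  positive word of length \<open>n\<close>, there is room for nothing else, so every \<open>w\<^sub>i\<close> is empty and the tuple
  is \<open>t\<close>.
\<close>

section \<open>Words\<close>

abbreviation word_inv :: "'a letter list \<Rightarrow> 'a letter list"
  where "word_inv w \<equiv> rev (map flip w)"

text \<open>Kept as an unreduced list: the length of \<open>w\<close> is what the descent
  measures.\<close>

definition conj_word :: "'a letter list \<Rightarrow> 'a \<Rightarrow> 'a letter list"
  where "conj_word w s = word_inv w @ (s, True) # w"

section \<open>Free reduction inside longer words\<close>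

lemma reduced_append:
  "reduced (u @ v) \<longleftrightarrow> reduced u \<and> reduced v \<and> (u = [] \<or> v = [] \<or> hd v \<noteq> flip (last u))"
  by (auto simp: reduced_def successively_append_iff)

lemma word_inv_word_inv [simp]: "word_inv (word_inv w) = w"
  by (simp add: rev_map comp_def)

lemma hd_word_inv: "w \<noteq> [] \<Longrightarrow> hd (word_inv w) = flip (last w)"
  by (simp add: hd_rev last_map)

lemma foldr_cancel_cons_append_inverse:
  assumes "reduced r"
  shows "foldr cancel_cons (u @ z @ word_inv z @ v) r = foldr cancel_cons (u @ v) r"
proof -
  have "foldr cancel_cons z (foldr cancel_cons (word_inv z) r') = r'" if "reduced r'" for r'
    using foldr_cancel_cons_assoc[OF that, of z "word_inv z"]
      foldr_cancel_cons_inverse[of "word_inv z"] by simp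
  then show ?thesis
    using assms by (simp add: foldr_cancel_cons_reduced)
qed

lemma foldr_cancel_cons_remove_pair:
  "reduced r \<Longrightarrow> foldr cancel_cons (u @ a # flip a # v) r = foldr cancel_cons (u @ v) r"
  using foldr_cancel_cons_append_inverse[of r u "[a]" v] by simp

lemma not_reduced_split:
  "\<not> reduced w \<Longrightarrow> \<exists>u a v. w = u @ a # flip a # v"
proof (induction w)
  case (Cons b w)
  show ?case
  proof (cases "reduced w")
    case True
    then obtain v where "w = flip b # v"
      using Cons.prems by (cases w) (auto simp: reduced_Cons)
    then show ?thesis by (metis append_Nil)
  next
    case False
    then show ?thesis using Cons.IH by (metis append_Cons)
  qed
qed simp

lemma conj_word_shorten:
  assumes "\<not> reduced (conj_word w s)"
  shows "\<exists>w'. length w' < length w \<and> set w' \<subseteq> set w \<and>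
    foldr cancel_cons (conj_word w' s) [] = foldr cancel_cons (conj_word w s) []"
proof (cases "reduced w")
  case False
  then obtain u a v where w: "w = u @ a # flip a # v"
    using not_reduced_split by blast
  \<comment> \<open>The inverse of \<open>u @ a # flip a # v\<close> contains the same pair
    \<open>a\<close>, \<open>flip a\<close>; it is removed first, the pair in \<open>w\<close>
    second.\<close>
  have "foldr cancel_cons (conj_word w s) [] =
      foldr cancel_cons (word_inv v @ a # flip a # (word_inv u @ (s, True) # u @ a # flip a # v)) []"
    by (simp add: conj_word_def w)
  also have "\<dots> = foldr cancel_cons ((word_inv v @ word_inv u @ (s, True) # u) @ a # flip a # v) []"
    by (subst foldr_cancel_cons_remove_pair) simp_all
  also have "\<dots> = foldr cancel_cons (conj_word (u @ v) s) []"
    by (subst foldr_cancel_cons_remove_pair) (simp_all add: conj_word_def)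
  finally show ?thesis
    by (intro exI[of _ "u @ v"]) (auto simp: w)
next
  case True
  then obtain b v where w: "w = b # v" and b: "fst b = s"
  proof (cases w)
    case Nil
    then show ?thesis using assms by (simp add: conj_word_def)
  next
    case (Cons b v)
    \<comment> \<open>If \<open>w\<close> started with a letter of another generator, neither seam
      at the central letter would cancel.\<close>
    moreover have "fst b = s"
    proof (rule ccontr)
      assume "fst b \<noteq> s"
      then have "b \<noteq> flip (s, True)" "(s, True) \<noteq> b"
        by (auto simp: flip_def)
      then have "reduced (conj_word w s)"
        using True reduced_inverse[OF True] Cons
        by (auto simp: conj_word_def reduced_append reduced_Cons)
      then show False using assms by simp
    qed
    ultimately show ?thesis using that by blast
  qed
  \<comment> \<open>The sign of \<open>b\<close> decides whether the central letter cancels to the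
    left or to the right; the remaining letter \<open>(s, True)\<close> becomes the new
    centre.\<close>
  have "foldr cancel_cons (conj_word w s) [] = foldr cancel_cons (conj_word v s) []"
  proof (cases "snd b")
    case True
    then have b: "b = (s, True)" using b by (cases b) auto
    have "foldr cancel_cons (conj_word w s) [] =
        foldr cancel_cons (word_inv v @ flip b # flip (flip b) # b # v) []"
      by (simp add: conj_word_def w b)
    then show ?thesis
      by (subst (asm) foldr_cancel_cons_remove_pair) (simp_all add: conj_word_def b)
  next
    case False
    then have b: "b = flip (s, True)" using b by (cases b) (auto simp: flip_def)
    have "foldr cancel_cons (conj_word w s) [] =
        foldr cancel_cons ((word_inv v @ [(s, True)]) @ (s, True) # flip (s, True) # v) []"
      by (simp add: conj_word_def w b)
    then show ?thesis
      by (subst (asm) foldr_cancel_cons_remove_pair) (simp_all add: conj_word_def)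
  qed
  then show ?thesis by (intro exI[of _ v]) (auto simp: w)
qed

section \<open>Products of conjugates in which all central letters survive\<close>

lemma longest_common_suffix_split:
  "\<exists>p q z. u = p @ z \<and> v = q @ z \<and> (p = [] \<or> q = [] \<or> last p \<noteq> last q)"
proof (induction u arbitrary: v rule: rev_induct)
  case (snoc a u)
  show ?case
  proof (cases "v \<noteq> [] \<and> last v = a")
    case True
    then obtain v' where v: "v = v' @ [a]" by (metis append_butlast_last_id)
    obtain p q z where "u = p @ z" "v' = q @ z" "p = [] \<or> q = [] \<or> last p \<noteq> last q"
      using snoc by blast
    then have "u @ [a] = p @ (z @ [a]) \<and> v = q @ (z @ [a]) \<and> (p = [] \<or> q = [] \<or> last p \<noteq> last q)"
      by (simp add: v)
    then show ?thesis by blast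
  next
    case False
    then have "u @ [a] = (u @ [a]) @ [] \<and> v = v @ [] \<and>
        (u @ [a] = [] \<or> v = [] \<or> last (u @ [a]) \<noteq> last v)"
      by auto
    then show ?thesis by blast
  qed
qed auto

text \<open>
  A pair \<open>(w, s)\<close> stands for the conjugate of the generator \<open>s\<close> by \<open>w\<close>. When
  \<open>no_collision\<close> fails, a Hurwitz move or its inverse shortens the conjugating words.
\<close>

definition no_collision :: "'a letter list \<times> 'a \<Rightarrow> 'a letter list \<times> 'a \<Rightarrow> bool"
  where "no_collision a b \<longleftrightarrow>
    (\<forall>q. fst b \<noteq> q @ (snd a, True) # fst a) \<and> (\<forall>p. fst a \<noteq> p @ (snd b, False) # fst b)"

text \<open>Induction from the right. The first factor is recorded up to its central letter because
  this is the part that the next factor to the left meets. The bound on \<open>R\<close> counts a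
  surviving central letter for each further factor.\<close>

lemma product_no_collision:
  assumes "\<And>a. a \<in> set (c # L) \<Longrightarrow> reduced (conj_word (fst a) (snd a))"
    and "successively no_collision (c # L)"
  shows "\<exists>R. foldr cancel_cons (concat (map (\<lambda>a. conj_word (fst a) (snd a)) (c # L))) [] =
    word_inv (fst c) @ (snd c, True) # R \<and> length L \<le> length R"
  using assms
proof (induction L arbitrary: c)
  case Nil
  then have "reduced (conj_word (fst c) (snd c))" by simp
  then show ?case
    by (simp add: foldr_cancel_cons_Nil) (simp add: conj_word_def)
next
  case (Cons c' L)
  define w s w' s' where ws: "w = fst c" "s = snd c" "w' = fst c'" "s' = snd c'"
  define P where "P = foldr cancel_cons (concat (map (\<lambda>a. conj_word (fst a) (snd a)) (c' # L))) []"
  obtain R where R: "P = word_inv w' @ (s', True) # R" "length L \<le> length R"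
    using Cons.IH[of c'] Cons.prems by (auto simp: P_def ws)
  have P: "reduced P" unfolding P_def by (rule foldr_cancel_cons_reduced) simp
  have c: "reduced (conj_word w s)" using Cons.prems by (simp add: ws)
  have nc: "\<And>q. w' \<noteq> q @ (s, True) # w" "\<And>p. w \<noteq> p @ (s', False) # w'"
    using Cons.prems(2) by (auto simp: no_collision_def ws)
  \<comment> \<open>At the seam between \<open>w\<close> and \<open>word_inv w'\<close> exactly the
    common suffix \<open>z\<close> cancels, which leaves \<open>M\<close>.\<close>
  obtain p q z where pqz: "w = p @ z" "w' = q @ z" "p = [] \<or> q = [] \<or> last p \<noteq> last q"
    using longest_common_suffix_split by blast
  define M where "M = word_inv w @ (s, True) # p @ word_inv q @ (s', True) # R"
  have left: "reduced (word_inv w @ (s, True) # p)"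
  proof -
    have "conj_word w s = (word_inv w @ (s, True) # p) @ z"
      unfolding conj_word_def by (simp add: pqz(1))
    then show ?thesis using c reduced_append by metis
  qed
  have right: "reduced (word_inv q @ (s', True) # R)"
    using P reduced_append[of "word_inv z"] by (simp add: R pqz(2))
  \<comment> \<open>If \<open>p\<close> and \<open>q\<close> are both nonempty, maximality of
    \<open>z\<close> prevents further cancellation. If exactly one is empty, a central letter lies
    at the seam and \<open>no_collision\<close> protects it. If both are empty, two positive letters
    meet.\<close>
  have "hd (word_inv q @ (s', True) # R) \<noteq> flip (last (word_inv w @ (s, True) # p))"
  proof (cases "q = []"; cases "p = []")
    assume "q = []" "p = []"
    then show ?thesis by (simp add: flip_def)
  next
    assume qp: "q = []" "p \<noteq> []"
    have "last p \<noteq> (s', False)"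
      using nc(2)[of "butlast p"] qp pqz by (metis append_Nil append.assoc append_Cons append_butlast_last_id)
    then show ?thesis using qp by (auto simp: flip_def prod_eq_iff)
  next
    assume qp: "q \<noteq> []" "p = []"
    have "last q \<noteq> (s, True)"
      using nc(1)[of "butlast q"] qp pqz by (metis append_Nil append.assoc append_Cons append_butlast_last_id)
    then show ?thesis using qp by (simp add: hd_word_inv hd_append)
  next
    assume "q \<noteq> []" "p \<noteq> []"
    then show ?thesis using pqz(3) by (auto simp: hd_word_inv hd_append)
  qed
  then have M: "reduced M"
    using left right reduced_append[of "word_inv w @ (s, True) # p" "word_inv q @ (s', True) # R"]
    by (simp add: M_def)
  have "foldr cancel_cons (concat (map (\<lambda>a. conj_word (fst a) (snd a)) (c # c' # L))) [] =
      foldr cancel_cons (conj_word w s) P"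
    by (simp add: P_def ws)
  also have "\<dots> = foldr cancel_cons (conj_word w s @ P) []"
    using foldr_cancel_cons_Nil[OF P] by simp
  also have "conj_word w s @ P =
      (word_inv w @ (s, True) # p) @ z @ word_inv z @ (word_inv q @ (s', True) # R)"
    unfolding conj_word_def R(1) by (simp add: pqz(1,2))
  also have "foldr cancel_cons \<dots> [] = foldr cancel_cons M []"
    by (subst foldr_cancel_cons_append_inverse) (simp_all add: M_def)
  also have "\<dots> = M" by (rule foldr_cancel_cons_Nil[OF M])
  finally show ?case
    using R(2) by (intro exI[of _ "p @ word_inv q @ (s', True) # R"]) (simp add: M_def ws)
qed

text \<open>The product has as many letters as factors and every central letter survives, so no room
  is left for the first conjugating word. Cancelling the first generator on both sides leaves the
  same situation for the tail.\<close>

lemma positive_product_no_collision: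
  assumes "\<And>a. a \<in> set L \<Longrightarrow> reduced (conj_word (fst a) (snd a))"
    and "successively no_collision L"
    and "foldr cancel_cons (concat (map (\<lambda>a. conj_word (fst a) (snd a)) L)) [] =
      map (\<lambda>s. (s, True)) ss"
    and "length ss = length L"
  shows "L = map (Pair []) ss"
  using assms
proof (induction L arbitrary: ss)
  case (Cons c L)
  define P where "P = foldr cancel_cons (concat (map (\<lambda>a. conj_word (fst a) (snd a)) L)) []"
  obtain s ss' where ss: "ss = s # ss'" using Cons.prems(4) by (cases ss) auto
  obtain R where R: "map (\<lambda>s. (s, True)) ss = word_inv (fst c) @ (snd c, True) # R"
      "length L \<le> length R"
    using product_no_collision[OF Cons.prems(1,2)] Cons.prems(3) by auto
  have "length ss = length (fst c) + Suc (length R)"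
    using arg_cong[OF R(1), of length] by simp
  then have c1: "fst c = []" using R(2) Cons.prems(4) by simp
  then have c2: "snd c = s" "R = map (\<lambda>s. (s, True)) ss'" using R(1) by (auto simp: ss)
  have P: "reduced P" unfolding P_def by (rule foldr_cancel_cons_reduced) simp
  have "cancel_cons (s, True) P = (s, True) # R"
    using Cons.prems(3) c1 c2 by (simp add: P_def conj_word_def ss)
  then have "P = cancel_cons (flip (s, True)) ((s, True) # R)"
    using cancel_cons_flip[OF P, of "flip (s, True)"] by simp
  also have "\<dots> = R" by (simp add: cancel_cons_def)
  finally have PR: "P = R" .
  have "L = map (Pair []) ss'"
  proof (rule Cons.IH)
    show "successively no_collision L" using Cons.prems(2) by (auto simp: successively_Cons)
  qed (use Cons.prems c2 ss PR in \<open>simp_all add: P_def\<close>)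
  then show ?case using c1 c2 by (simp add: ss prod_eq_iff)
qed simp

section \<open>Invariants of the Hurwitz action\<close>

context group
begin

text \<open>A braid is represented by a word in the standard generators and their inverses, so the
  claim follows letter by letter. Since \<open>P\<close> is preserved as an equivalence, one
  hypothesis serves both signs.\<close>

lemma hurwitz_action_invariant:
  assumes P: "\<And>i g. i \<in> {1..<n} \<Longrightarrow> g \<in> {1..n} \<rightarrow>\<^sub>E carrier G \<Longrightarrow>
      P (hurwitz_move G n i g) \<longleftrightarrow> P g"
    and b: "b \<in> carrier (braid_group n)" and g: "g \<in> {1..n} \<rightarrow>\<^sub>E carrier G"
  shows "P (hurwitz_action G n b g) \<longleftrightarrow> P g"
proof -
  define S where "S = {1..n} \<rightarrow>\<^sub>E carrier G"
  define m where "m = hurwitz_move G n"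
  have cB: "carrier (BijGroup S) = Bij S" by (simp add: BijGroup_def)
  have mB: "m i \<in> Bij S" if "i \<in> {1..<n}" for i
    using hurwitz_move_Bij[OF that] by (simp add: m_def S_def)
  obtain w where w: "w \<in> carrier (free_group {1..<n})"
      "b = normal_closure (free_group {1..<n}) (braid_relators n) #>\<^bsub>free_group {1..<n}\<^esub> w"
    using b by (auto simp: braid_group_def presented_group_def FactGroup_def RCOSETS_def)
  have "set w \<subseteq> {1..<n} \<times> UNIV" using w by (auto simp: free_group_def)
  \<comment> \<open>Membership in \<open>Bij S\<close> is carried along because multiplication in
    \<open>BijGroup S\<close> is composition only on bijections.\<close>
  then have "free_group_lift (BijGroup S) m w \<in> Bij S \<and>
      (P (free_group_lift (BijGroup S) m w g) \<longleftrightarrow> P g)"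
  proof (induction w)
    case Nil
    then show ?case using g monoid.one_closed[OF group.is_monoid[OF group_BijGroup]] cB
      by (simp add: free_group_lift_def) (simp add: BijGroup_def S_def)
  next
    case (Cons a w)
    define h where "h = free_group_lift (BijGroup S) m w"
    have h: "h \<in> Bij S" "P (h g) \<longleftrightarrow> P g" using Cons by (auto simp: h_def)
    have hg: "h g \<in> S" using h(1) g by (auto simp: Bij_def bij_betw_def S_def)
    define f where "f = (if snd a then m (fst a) else inv\<^bsub>BijGroup S\<^esub> m (fst a))"
    have a: "fst a \<in> {1..<n}" using Cons.prems by auto
    have fB: "f \<in> Bij S"
      using group.inv_closed[OF group_BijGroup, of "m (fst a)" S] mB[OF a] by (simp add: f_def cB)
    have "P (f (h g)) \<longleftrightarrow> P (h g)"
    proof (cases "snd a")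
      case True
      then show ?thesis using P[OF a] hg by (simp add: f_def m_def S_def)
    next
      case False
      \<comment> \<open>An inverse letter sends \<open>h g\<close> to its preimage \<open>k\<close>,
        and the hypothesis is read at \<open>k\<close>.\<close>
      define k where "k = inv_into S (m (fst a)) (h g)"
      have im: "m (fst a) ` S = S" using mB[OF a] by (auto simp: Bij_def bij_betw_def)
      have "f (h g) = k"
        using False hg by (simp add: f_def inv_BijGroup mB[OF a] k_def)
      moreover have "k \<in> S" "m (fst a) k = h g"
        using im hg by (auto simp: k_def f_inv_into_f inv_into_into)
      ultimately show ?thesis using P[OF a, of k] by (simp add: m_def S_def)
    qed
    moreover have "free_group_lift (BijGroup S) m (a # w) = f \<otimes>\<^bsub>BijGroup S\<^esub> h"
      by (simp add: free_group_lift_def f_def h_def)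
    then have "free_group_lift (BijGroup S) m (a # w) = compose S f h"
      using fB h(1) by (simp add: BijGroup_def)
    ultimately show ?case
      using fB h g by (simp add: compose_Bij) (simp add: compose_def S_def)
  qed
  then show ?thesis using hurwitz_action_coset[OF w(1)] w(2) by (simp add: S_def m_def)
qed

text \<open>A move is the action of a standard generator and orbits are equivalence classes, so the
  descent may use moves and their inverses alike.\<close>

lemma hurwitz_move_orbit_iff:
  assumes i: "i \<in> {1..<n}" and g: "g \<in> {1..n} \<rightarrow>\<^sub>E carrier G" and t: "t \<in> {1..n} \<rightarrow>\<^sub>E carrier G"
  shows "hurwitz_move G n i g \<in> orbit (braid_group n) (hurwitz_action G n) t \<longleftrightarrow>
    g \<in> orbit (braid_group n) (hurwitz_action G n) t"
proof -
  note A = group_action_hurwitz[of n]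
  note m = hurwitz_move_closed[OF i g]
  have "braid_gen n i \<in> carrier (braid_group n)"
    using free_gen_closed[OF i]
    by (auto simp: braid_gen_def presented_gen_def braid_group_def presented_group_def
        FactGroup_def RCOSETS_def)
  then have "hurwitz_move G n i g \<in> orbit (braid_group n) (hurwitz_action G n) g"
    using hurwitz_action_gen[OF i] unfolding orbit_def by force
  then show ?thesis
    using group_action.orbit_trans[OF A] group_action.orbit_sym[OF A] m g t by meson
qed

section \<open>Product and conjugacy classes under a Hurwitz move\<close>

lemma foldr_mult_closed: "set xs \<subseteq> carrier G \<Longrightarrow> foldr (\<otimes>) xs \<one> \<in> carrier G"
  by (induction xs) auto

text \<open>Locally this is the identity \<open>b (b^-1 a b) = a b\<close>.\<close>

lemma tuple_prod_hurwitz_move: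
  assumes i: "i \<in> {1..<n}" and g: "g \<in> {1..n} \<rightarrow>\<^sub>E carrier G"
  shows "tuple_prod G n (hurwitz_move G n i g) = tuple_prod G n g"
proof -
  define h where "h = hurwitz_move G n i g"
  have split: "[1..<n + 1] = [1..<i] @ i # (i + 1) # [i + 2..<n + 1]"
    using i upt_add_eq_append[of 1 i "n + 1 - i"] by (simp add: upt_conv_Cons)
  have h: "h i = g (i + 1)" "h (i + 1) = inv (g (i + 1)) \<otimes> g i \<otimes> g (i + 1)"
      "\<And>k. k \<noteq> i \<Longrightarrow> k \<noteq> i + 1 \<Longrightarrow> h k = g k"
    using g by (auto simp: h_def hurwitz_move_def)
  have c: "g i \<in> carrier G" "g (i + 1) \<in> carrier G" using i g PiE_entry[OF g] by auto
  define r where "r = foldr (\<otimes>) (map g [i + 2..<n + 1]) \<one>"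
  have r: "r \<in> carrier G"
    unfolding r_def using PiE_entry[OF g] by (intro foldr_mult_closed) auto
  have m: "map h [1..<i] = map g [1..<i]" "map h [i + 2..<n + 1] = map g [i + 2..<n + 1]"
    using h by auto
  have "tuple_prod G n h = foldr (\<otimes>) (map g [1..<i]) (h i \<otimes> (h (i + 1) \<otimes> r))"
    unfolding tuple_prod_def split r_def map_append list.map m by simp
  also have "h i \<otimes> (h (i + 1) \<otimes> r) = g i \<otimes> (g (i + 1) \<otimes> r)"
    unfolding h using c r by (simp add: m_assoc inv_cancel_left)
  also have "foldr (\<otimes>) (map g [1..<i]) \<dots> = tuple_prod G n g"
    unfolding tuple_prod_def split r_def map_append list.map by simp
  finally show ?thesis by (simp add: h_def)
qed

lemma conjugacy_class_conj_iff:
  assumes a: "a \<in> carrier G" and b: "b \<in> carrier G" and x: "x \<in> carrier G"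
  shows "inv b \<otimes> a \<otimes> b \<in> conjugacy_class G x \<longleftrightarrow> a \<in> conjugacy_class G x"
proof
  assume "inv b \<otimes> a \<otimes> b \<in> conjugacy_class G x"
  then obtain h where h: "h \<in> carrier G" "inv b \<otimes> a \<otimes> b = h \<otimes> x \<otimes> inv h"
    by (auto simp: conjugacy_class_def)
  have "a = b \<otimes> (inv b \<otimes> a \<otimes> b) \<otimes> inv b"
    using a b by (simp add: m_assoc inv_cancel_left)
  also have "\<dots> = (b \<otimes> h) \<otimes> x \<otimes> inv (b \<otimes> h)"
    unfolding h(2) using b h(1) x by (simp add: m_assoc inv_mult_group)
  finally show "a \<in> conjugacy_class G x"
    using b h(1) unfolding conjugacy_class_def by blast
next
  assume "a \<in> conjugacy_class G x"
  then obtain h where h: "h \<in> carrier G" "a = h \<otimes> x \<otimes> inv h"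
    by (auto simp: conjugacy_class_def)
  have "inv b \<otimes> a \<otimes> b = (inv b \<otimes> h) \<otimes> x \<otimes> inv (inv b \<otimes> h)"
    unfolding h(2) using b h(1) x by (simp add: m_assoc inv_mult_group)
  then show "inv b \<otimes> a \<otimes> b \<in> conjugacy_class G x"
    using b h(1) unfolding conjugacy_class_def by blast
qed

text \<open>A move exchanges two entries up to conjugation, so a permutation matching the entries
  with those of \<open>t\<close> only has to be composed with the transposition of \<open>i\<close>
  and \<open>i + 1\<close>.\<close>

lemma hurwitz_move_conjugacy_classes_iff:
  assumes i: "i \<in> {1..<n}" and g: "g \<in> {1..n} \<rightarrow>\<^sub>E carrier G" and t: "t \<in> {1..n} \<rightarrow>\<^sub>E carrier G"
  shows "(\<exists>\<tau>. \<tau> permutes {1..n} \<and> (\<forall>k\<in>{1..n}. hurwitz_move G n i g k \<in> conjugacy_class G (t (\<tau> k))))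
    \<longleftrightarrow> (\<exists>\<tau>. \<tau> permutes {1..n} \<and> (\<forall>k\<in>{1..n}. g k \<in> conjugacy_class G (t (\<tau> k))))"
proof -
  let ?\<pi> = "Transposition.transpose i (i + 1)"
  define h where "h = hurwitz_move G n i g"
  have h: "h i = g (i + 1)" "h (i + 1) = inv (g (i + 1)) \<otimes> g i \<otimes> g (i + 1)"
      "\<And>k. k \<noteq> i \<Longrightarrow> k \<noteq> i + 1 \<Longrightarrow> h k = g k"
    using g by (auto simp: h_def hurwitz_move_def)
  have in_n: "i \<in> {1..n}" "i + 1 \<in> {1..n}" using i by auto
  have \<pi>: "?\<pi> permutes {1..n}" using in_n by (rule permutes_swap_id)
  have iff: "(\<forall>k\<in>{1..n}. h k \<in> conjugacy_class G (t ((\<tau> \<circ> ?\<pi>) k))) \<longleftrightarrow>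
      (\<forall>k\<in>{1..n}. g k \<in> conjugacy_class G (t (\<tau> k)))" if \<tau>: "\<tau> permutes {1..n}" for \<tau>
  proof -
    have entry: "h k \<in> conjugacy_class G (t (\<tau> (?\<pi> k))) \<longleftrightarrow>
        g (?\<pi> k) \<in> conjugacy_class G (t (\<tau> (?\<pi> k)))" if "k \<in> {1..n}" for k
    proof -
      have "t (\<tau> i) \<in> carrier G" using t in_n permutes_in_image[OF \<tau>, of i] by auto
      moreover have "g i \<in> carrier G" "g (i + 1) \<in> carrier G" using g in_n by auto
      ultimately have "h (i + 1) \<in> conjugacy_class G (t (\<tau> i)) \<longleftrightarrow> g i \<in> conjugacy_class G (t (\<tau> i))"
        unfolding h(2) by (intro conjugacy_class_conj_iff)
      then show ?thesis
        by (cases "k = i"; cases "k = i + 1") (simp_all add: h)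
    qed
    have "(\<forall>k\<in>{1..n}. g (?\<pi> k) \<in> conjugacy_class G (t (\<tau> (?\<pi> k)))) \<longleftrightarrow>
        (\<forall>k\<in>?\<pi> ` {1..n}. g k \<in> conjugacy_class G (t (\<tau> k)))"
      by blast
    also have "?\<pi> ` {1..n} = {1..n}" by (rule permutes_image[OF \<pi>])
    finally show ?thesis using entry unfolding comp_apply by blast
  qed
  show ?thesis
    unfolding h_def[symmetric]
  proof
    assume "\<exists>\<tau>. \<tau> permutes {1..n} \<and> (\<forall>k\<in>{1..n}. h k \<in> conjugacy_class G (t (\<tau> k)))"
    then obtain \<tau> where \<tau>: "\<tau> permutes {1..n}" "\<forall>k\<in>{1..n}. h k \<in> conjugacy_class G (t (\<tau> k))"
      by blast
    have perm: "(\<tau> \<circ> ?\<pi>) permutes {1..n}" using permutes_compose[OF \<pi> \<tau>(1)] .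
    \<comment> \<open>The transposition is an involution, so \<open>iff\<close> taken at the
      composed permutation yields this direction too.\<close>
    have "(\<tau> \<circ> ?\<pi>) \<circ> ?\<pi> = \<tau>" by (simp add: comp_assoc)
    then have "\<forall>k\<in>{1..n}. g k \<in> conjugacy_class G (t ((\<tau> \<circ> ?\<pi>) k))"
      using iff[OF perm] \<tau>(2) by (simp only:)
    with perm show "\<exists>\<tau>. \<tau> permutes {1..n} \<and> (\<forall>k\<in>{1..n}. g k \<in> conjugacy_class G (t (\<tau> k)))"
      by blast
  next
    assume "\<exists>\<tau>. \<tau> permutes {1..n} \<and> (\<forall>k\<in>{1..n}. g k \<in> conjugacy_class G (t (\<tau> k)))"
    then obtain \<tau> where \<tau>: "\<tau> permutes {1..n}" "\<forall>k\<in>{1..n}. g k \<in> conjugacy_class G (t (\<tau> k))"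
      by blast
    have "(\<tau> \<circ> ?\<pi>) permutes {1..n}" using permutes_compose[OF \<pi> \<tau>(1)] .
    moreover have "\<forall>k\<in>{1..n}. h k \<in> conjugacy_class G (t ((\<tau> \<circ> ?\<pi>) k))"
      using iff[OF \<tau>(1)] \<tau>(2) by (simp only:)
    ultimately show "\<exists>\<tau>. \<tau> permutes {1..n} \<and> (\<forall>k\<in>{1..n}. h k \<in> conjugacy_class G (t (\<tau> k)))"
      by blast
  qed
qed

end

section \<open>Conjugates of generators\<close>

text \<open>Different words \<open>w\<close> may give the same element, so the descent runs over
  words and reaches elements through this map.\<close>

definition conj_elt :: "'a letter list \<Rightarrow> 'a \<Rightarrow> 'a letter list"
  where "conj_elt w s = foldr cancel_cons (conj_word w s) []"

lemma free_group_mult: "u \<otimes>\<^bsub>free_group X\<^esub> v = foldr cancel_cons u v"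
  by (simp add: free_group_def)

lemma free_group_one: "\<one>\<^bsub>free_group X\<^esub> = []"
  by (simp add: free_group_def)

lemma free_group_reduce_closed:
  "set w \<subseteq> X \<times> UNIV \<Longrightarrow> foldr cancel_cons w [] \<in> carrier (free_group X)"
  using set_foldr_cancel_cons[of w "[]"] by (auto simp: free_group_def foldr_cancel_cons_reduced)

text \<open>Reduction is a homomorphism from words under concatenation. As \<open>X\<close> does not
  occur on the left, rewriting instantiates it explicitly.\<close>

lemma free_group_reduce_append:
  "foldr cancel_cons (u @ v) [] =
    foldr cancel_cons u [] \<otimes>\<^bsub>free_group X\<^esub> foldr cancel_cons v []"
  by (simp add: free_group_mult foldr_cancel_cons_assoc foldr_cancel_cons_reduced)

lemma set_word_inv_subset: "set w \<subseteq> X \<times> UNIV \<Longrightarrow> set (word_inv w) \<subseteq> X \<times> UNIV"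
  by (force simp: flip_def)

lemma free_group_reduce_inverse:
  assumes w: "set w \<subseteq> X \<times> UNIV"
  shows "foldr cancel_cons (word_inv w) [] = inv\<^bsub>free_group X\<^esub> foldr cancel_cons w []"
proof -
  interpret group "free_group X" by (rule group_free_group)
  have "foldr cancel_cons (word_inv w) [] \<otimes>\<^bsub>free_group X\<^esub> foldr cancel_cons w [] = \<one>\<^bsub>free_group X\<^esub>"
    using foldr_cancel_cons_append_inverse[of "[]" "[]" "word_inv w" "[]"]
    by (subst free_group_reduce_append[symmetric]) (simp add: free_group_one)
  then show ?thesis
    using free_group_reduce_closed[OF w] free_group_reduce_closed[OF set_word_inv_subset[OF w]]
    by (metis inv_equality)
qed

lemma conj_elt_closed:
  "set w \<subseteq> X \<times> UNIV \<Longrightarrow> s \<in> X \<Longrightarrow> conj_elt w s \<in> carrier (free_group X)"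
  unfolding conj_elt_def using set_word_inv_subset[of w X]
  by (intro free_group_reduce_closed) (auto simp: conj_word_def)

lemma conj_elt_eq:
  assumes w: "set w \<subseteq> X \<times> UNIV"
  shows "conj_elt w s = inv\<^bsub>free_group X\<^esub> (foldr cancel_cons w []) \<otimes>\<^bsub>free_group X\<^esub>
    (free_gen s \<otimes>\<^bsub>free_group X\<^esub> foldr cancel_cons w [])"
proof -
  have "conj_word w s = word_inv w @ [(s, True)] @ w" by (simp add: conj_word_def)
  then show ?thesis
    unfolding conj_elt_def free_group_reduce_inverse[OF w, symmetric]
    by (simp only: free_group_reduce_append[where X = X])
      (simp add: free_gen_def cancel_cons_def)
qed

text \<open>The effect of a Hurwitz move on conjugating words: multiplied by
  \<open>w^-1 s' w\<close> on the right, \<open>p s'^-1 w\<close> becomes \<open>p w\<close>, and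
  \<open>p w\<close> becomes \<open>p s' w\<close>. The first shortens by a move, the second, read
  backwards, by an inverse move.\<close>

lemma conj_elt_conj:
  assumes p: "set p \<subseteq> X \<times> UNIV" and w: "set w \<subseteq> X \<times> UNIV" and s: "s \<in> X" and s': "s' \<in> X"
  defines "F \<equiv> free_group X"
  shows "inv\<^bsub>F\<^esub> (conj_elt w s') \<otimes>\<^bsub>F\<^esub> conj_elt (p @ (s', False) # w) s \<otimes>\<^bsub>F\<^esub> conj_elt w s' =
      conj_elt (p @ w) s"
    and "inv\<^bsub>F\<^esub> (conj_elt w s') \<otimes>\<^bsub>F\<^esub> conj_elt (p @ w) s \<otimes>\<^bsub>F\<^esub> conj_elt w s' =
      conj_elt (p @ (s', True) # w) s"
proof -
  interpret group F unfolding F_def by (rule group_free_group)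
  \<comment> \<open>Once words are replaced by the elements they represent, both claims are
    identities valid in any group.\<close>
  define a b where ab: "a = foldr cancel_cons p []" "b = foldr cancel_cons w []"
  have c: "a \<in> carrier F" "b \<in> carrier F" "free_gen s \<in> carrier F" "free_gen s' \<in> carrier F"
    using free_group_reduce_closed p w s s' free_gen_closed by (auto simp: ab F_def)
  have s'F: "foldr cancel_cons [(s', False)] [] = inv\<^bsub>F\<^esub> free_gen s'"
  proof -
    have "foldr cancel_cons (word_inv [(s', True)]) [] =
        inv\<^bsub>free_group X\<^esub> foldr cancel_cons [(s', True)] []"
      using s' by (intro free_group_reduce_inverse) simp
    moreover have "foldr cancel_cons [a] [] = [a]" for a :: "'a letter"
      by (simp add: cancel_cons_def)
    ultimately show ?thesis
      by (simp only: F_def free_gen_def) (simp add: flip_def)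
  qed
  have s'T: "foldr cancel_cons [(s', True)] [] = free_gen s'"
    by (simp add: free_gen_def cancel_cons_def)
  have e: "foldr cancel_cons (p @ w) [] = a \<otimes>\<^bsub>F\<^esub> b"
      "foldr cancel_cons (p @ [(s', False)] @ w) [] = a \<otimes>\<^bsub>F\<^esub> (inv\<^bsub>F\<^esub> free_gen s' \<otimes>\<^bsub>F\<^esub> b)"
      "foldr cancel_cons (p @ [(s', True)] @ w) [] = a \<otimes>\<^bsub>F\<^esub> (free_gen s' \<otimes>\<^bsub>F\<^esub> b)"
    unfolding ab s'F[symmetric]
    unfolding s'T[symmetric] F_def
    by (simp_all only: free_group_reduce_append[where X = X])
  have sub: "set (p @ w) \<subseteq> X \<times> UNIV" "set (p @ [(s', False)] @ w) \<subseteq> X \<times> UNIV"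
      "set (p @ [(s', True)] @ w) \<subseteq> X \<times> UNIV"
    using p w s' by auto
  have "conj_elt w s' = inv\<^bsub>F\<^esub> b \<otimes>\<^bsub>F\<^esub> (free_gen s' \<otimes>\<^bsub>F\<^esub> b)"
    using conj_elt_eq[OF w] by (simp add: ab F_def)
  moreover have "conj_elt (p @ w) s = inv\<^bsub>F\<^esub> (a \<otimes>\<^bsub>F\<^esub> b) \<otimes>\<^bsub>F\<^esub> (free_gen s \<otimes>\<^bsub>F\<^esub> (a \<otimes>\<^bsub>F\<^esub> b))"
    using conj_elt_eq[OF sub(1), of s, folded F_def] unfolding e .
  moreover note conj_elt_eq[OF sub(2), of s, folded F_def, unfolded e]
    conj_elt_eq[OF sub(3), of s, folded F_def, unfolded e]
  ultimately show "inv\<^bsub>F\<^esub> (conj_elt w s') \<otimes>\<^bsub>F\<^esub> conj_elt (p @ (s', False) # w) s \<otimes>\<^bsub>F\<^esub> conj_elt w s' =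
      conj_elt (p @ w) s"
    and "inv\<^bsub>F\<^esub> (conj_elt w s') \<otimes>\<^bsub>F\<^esub> conj_elt (p @ w) s \<otimes>\<^bsub>F\<^esub> conj_elt w s' =
      conj_elt (p @ (s', True) # w) s"
    using c by (simp_all add: m_assoc inv_mult_group inv_cancel_left)
qed

section \<open>Tuple products as single words, and total length\<close>

lemma foldr_foldr_cancel_cons:
  "foldr (foldr cancel_cons) ws v = foldr cancel_cons (concat ws) v"
  by (induction ws) auto

lemma tuple_prod_free_group:
  "tuple_prod (free_group X) n g = foldr cancel_cons (concat (map g [1..<n + 1])) []"
  unfolding tuple_prod_def foldr_foldr_cancel_cons[symmetric]
  by (simp add: free_group_def cong: foldr_cong)

text \<open>Isolates the two positions that a move changes when total lengths are compared.\<close>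

lemma sum_adjacent:
  fixes f :: "nat \<Rightarrow> nat"
  assumes "i \<in> {1..<n}"
  shows "sum f {1..n} = f i + f (i + 1) + sum f ({1..n} - {i, i + 1})"
proof -
  have "sum f {1..n} = sum f {i, i + 1} + sum f ({1..n} - {i, i + 1})"
    using assms by (subst sum.subset_diff[of "{i, i + 1}"]) auto
  then show ?thesis by simp
qed

theorem theorem1p4:
  fixes n m :: nat
    and Q :: "nat \<Rightarrow> nat set"
    and t :: "nat \<Rightarrow> nat letter list"
  assumes "n \<ge> 1"
    and "partition_on {1..n} (Q ` {1..m})"
    and "inj_on Q {1..m}"
    and "t \<in> {1..n} \<rightarrow>\<^sub>E carrier (free_group {1..m})"
    and "\<And>i s. i \<in> {1..n} \<Longrightarrow> s \<in> {1..m} \<Longrightarrow> t i = free_gen s \<longleftrightarrow> i \<in> Q s"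
  shows "orbit (braid_group n) (hurwitz_action (free_group {1..m}) n) t =
    {g \<in> (\<Union>\<tau> \<in> {\<tau>. \<tau> permutes {1..n}}.
            \<Pi>\<^sub>E i\<in>{1..n}. conjugacy_class (free_group {1..m}) (t (\<tau> i))).
      tuple_prod (free_group {1..m}) n g = tuple_prod (free_group {1..m}) n t}"
proof -
  define X where "X = {1..m}"
  define F where "F = free_group X"
  interpret F: group F unfolding F_def by (rule group_free_group)
  define T where "T = {g \<in> (\<Union>\<tau> \<in> {\<tau>. \<tau> permutes {1..n}}.
            \<Pi>\<^sub>E i\<in>{1..n}. conjugacy_class F (t (\<tau> i))). tuple_prod F n g = tuple_prod F n t}"
  have tS: "t \<in> {1..n} \<rightarrow>\<^sub>E carrier F" using assms(4) by (simp add: F_def X_def)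
  \<comment> \<open>The parts cover \<open>{1..n}\<close>, so every entry of \<open>t\<close> is a
    generator; \<open>\<sigma>\<close> will record its index.\<close>
  have "\<exists>s\<in>X. t i = free_gen s" if i: "i \<in> {1..n}" for i
  proof -
    have "i \<in> \<Union> (Q ` {1..m})" using i assms(2) by (simp add: partition_on_def)
    then show ?thesis using assms(5)[OF i] by (auto simp: X_def)
  qed
  then obtain \<sigma> where \<sigma>: "\<And>i. i \<in> {1..n} \<Longrightarrow> \<sigma> i \<in> X"
      "\<And>i. i \<in> {1..n} \<Longrightarrow> t i = free_gen (\<sigma> i)" by metis
  have t: "t = (\<lambda>i\<in>{1..n}. free_gen (\<sigma> i))"
    using \<sigma>(2) tS by (auto simp: fun_eq_iff PiE_def extensional_def)
  have T_iff: "g \<in> T \<longleftrightarrow> (\<exists>\<tau>. \<tau> permutes {1..n} \<and> (\<forall>k\<in>{1..n}. g k \<in> conjugacy_class F (t (\<tau> k)))) \<and>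
      tuple_prod F n g = tuple_prod F n t" if "g \<in> {1..n} \<rightarrow>\<^sub>E carrier F" for g
    using that by (auto simp: T_def PiE_def Pi_iff)

  \<comment> \<open>The orbit has the right conjugacy classes and product\<close>
  have sub: "orbit (braid_group n) (hurwitz_action F n) t \<subseteq> T"
  proof
    fix g assume "g \<in> orbit (braid_group n) (hurwitz_action F n) t"
    then obtain b where b: "b \<in> carrier (braid_group n)" "g = hurwitz_action F n b t"
      by (auto simp: orbit_def)
    \<comment> \<open>Membership in \<open>T\<close> serves as the invariant predicate.\<close>
    have "hurwitz_move F n i h \<in> T \<longleftrightarrow> h \<in> T" if "i \<in> {1..<n}" "h \<in> {1..n} \<rightarrow>\<^sub>E carrier F" for i h
      using T_iff F.hurwitz_move_closed F.hurwitz_move_conjugacy_classes_iff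
        F.tuple_prod_hurwitz_move that tS by simp
    then have "g \<in> T \<longleftrightarrow> t \<in> T"
      unfolding b(2) using F.hurwitz_action_invariant[where P = "\<lambda>h. h \<in> T"] b(1) tS by blast
    moreover have self: "x \<in> conjugacy_class F x" if "x \<in> carrier F" for x
      using that by (auto simp: conjugacy_class_def intro!: exI[of _ "\<one>\<^bsub>F\<^esub>"])
    have "t \<in> T"
      unfolding T_iff[OF tS] using self F.PiE_entry[OF tS]
      by (auto intro!: exI[of _ id] permutes_id)
    ultimately show "g \<in> T" by simp
  qed
  \<comment> \<open>Tuples of conjugates are parametrised by words \<open>W\<close> and generators
    \<open>s\<close>; the restriction makes them equal to \<open>t\<close> as functions once the
    entries agree.\<close>
  define g where "g = (\<lambda>W s. \<lambda>i\<in>{1..n}. conj_elt (W i) (s i :: nat))"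
  have gS: "g W s \<in> {1..n} \<rightarrow>\<^sub>E carrier F"
    if "\<And>i. i \<in> {1..n} \<Longrightarrow> set (W i) \<subseteq> X \<times> UNIV" "\<And>i. i \<in> {1..n} \<Longrightarrow> s i \<in> X" for W s
    using that conj_elt_closed[of _ X] by (auto simp: g_def F_def)
  let ?O = "orbit (braid_group n) (hurwitz_action F n) t"

  \<comment> \<open>Descent on the total length of the conjugating words\<close>
  have descent: "g W s \<in> ?O"
    if "\<And>i. i \<in> {1..n} \<Longrightarrow> set (W i) \<subseteq> X \<times> UNIV" "\<And>i. i \<in> {1..n} \<Longrightarrow> s i \<in> X"
      "tuple_prod F n (g W s) = tuple_prod F n t" for W s
    using that
  \<comment> \<open>Both \<open>W\<close> and \<open>s\<close> vary, since a move swaps two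
    generators. That \<open>s\<close> agrees with \<open>\<sigma>\<close> emerges only where the
    descent ends.\<close>
  proof (induction "\<Sum>i\<in>{1..n}. length (W i)" arbitrary: W s rule: less_induct)
    case less
    note W = less.prems(1) and s = less.prems(2)
    note prod = less.prems(3)
    have IH: "g W' s' \<in> ?O"
      if "(\<Sum>i\<in>{1..n}. length (W' i)) < (\<Sum>i\<in>{1..n}. length (W i))"
        "\<And>i. i \<in> {1..n} \<Longrightarrow> set (W' i) \<subseteq> X \<times> UNIV" "\<And>i. i \<in> {1..n} \<Longrightarrow> s' i \<in> X"
        "tuple_prod F n (g W' s') = tuple_prod F n (g W s)" for W' s'
      using less.hyps[of W' s'] prod that by simp
    have IH_swap: "g W' s' \<in> ?O"
      if "i \<in> {1..<n}" "W' = W(i := u, i + 1 := v)" "s' = s(i := s (i + 1), i + 1 := s i)"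
        "length u + length v < length (W i) + length (W (i + 1))"
        "set u \<subseteq> X \<times> UNIV" "set v \<subseteq> X \<times> UNIV"
        "tuple_prod F n (g W' s') = tuple_prod F n (g W s)" for W' s' i u v
    proof (rule IH)
      have "(\<Sum>k\<in>{1..n} - {i, i + 1}. length (W' k)) = (\<Sum>k\<in>{1..n} - {i, i + 1}. length (W k))"
        using that(2) by (intro sum.cong) auto
      then show "(\<Sum>i\<in>{1..n}. length (W' i)) < (\<Sum>i\<in>{1..n}. length (W i))"
        unfolding sum_adjacent[OF that(1)] using that(2,4) by simp
    qed (use that W s in auto)
    show ?case
    proof (cases "\<exists>i\<in>{1..n}. \<not> reduced (conj_word (W i) (s i))")
      case True
      then obtain i where i: "i \<in> {1..n}" "\<not> reduced (conj_word (W i) (s i))" by blast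
      obtain w' where w': "length w' < length (W i)" "set w' \<subseteq> set (W i)"
          "conj_elt w' (s i) = conj_elt (W i) (s i)"
        using conj_word_shorten[OF i(2)] unfolding conj_elt_def by blast
      \<comment> \<open>The tuple stays the same; only its description gets shorter.\<close>
      have eq: "g (W(i := w')) s = g W s" using w'(3) by (auto simp: g_def fun_eq_iff)
      have "g (W(i := w')) s \<in> ?O"
      proof (rule IH)
        show "(\<Sum>k\<in>{1..n}. length ((W(i := w')) k)) < (\<Sum>k\<in>{1..n}. length (W k))"
          using i w' by (intro sum_strict_mono_ex1) auto
        show "set ((W(i := w')) k) \<subseteq> X \<times> UNIV" if "k \<in> {1..n}" for k
          using W[OF that] w'(2) by auto
      qed (simp_all only: s eq)
      then show ?thesis by (simp add: eq)
    next
      case red: False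
      show ?thesis
      proof (cases "\<exists>i\<in>{1..<n}. \<not> no_collision (W i, s i) (W (i + 1), s (i + 1))")
        case True
        then obtain i where i: "i \<in> {1..<n}" "\<not> no_collision (W i, s i) (W (i + 1), s (i + 1))"
          by blast
        have in_n: "i \<in> {1..n}" "i + 1 \<in> {1..n}" using i by auto
        let ?s = "s(i := s (i + 1), i + 1 := s i)"
        consider q where "W (i + 1) = q @ (s i, True) # W i"
          | p where "W i = p @ (s (i + 1), False) # W (i + 1)"
          using i(2) by (auto simp: no_collision_def)
        then show ?thesis
        proof cases
          case 1
          \<comment> \<open>The entry at \<open>i + 1\<close> is the longer one. \<open>W'\<close>
            describes the preimage of the tuple under the move, in which the letter
            \<open>(s i, True)\<close> is gone.\<close>
          define W' where "W' = W(i := q @ W i, i + 1 := W i)"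
          have q: "set q \<subseteq> X \<times> UNIV" using W[OF in_n(2)] 1 by auto
          have W': "g W' ?s \<in> {1..n} \<rightarrow>\<^sub>E carrier F"
            using W s in_n q by (intro gS) (auto simp: W'_def)
          have move: "hurwitz_move F n i (g W' ?s) = g W s"
            using W' in_n conj_elt_conj(2)[OF q W[OF in_n(1)] s[OF in_n(2)] s[OF in_n(1)]]
            by (auto simp: hurwitz_move_def fun_eq_iff g_def W'_def 1[simplified] F_def)
          have "g W' ?s \<in> ?O"
          proof (rule IH_swap[OF i(1) W'_def refl])
            show "tuple_prod F n (g W' ?s) = tuple_prod F n (g W s)"
              using F.tuple_prod_hurwitz_move[OF i(1) W'] unfolding move by simp
          qed (use W[OF in_n(1)] q in \<open>auto simp: 1[simplified]\<close>)
          then show ?thesis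
            using F.hurwitz_move_orbit_iff[OF i(1) W' tS] move by simp
        next
          case 2
          \<comment> \<open>The entry at \<open>i\<close> is the longer one. The move itself carries
            it to position \<open>i + 1\<close> and removes the letter
            \<open>(s (i + 1), False)\<close>.\<close>
          define W' where "W' = W(i := W (i + 1), i + 1 := p @ W (i + 1))"
          have p: "set p \<subseteq> X \<times> UNIV" using W[OF in_n(1)] 2 by auto
          have Ws: "g W s \<in> {1..n} \<rightarrow>\<^sub>E carrier F" by (rule gS[OF W s])
          have move: "hurwitz_move F n i (g W s) = g W' ?s"
            using Ws in_n conj_elt_conj(1)[OF p W[OF in_n(2)] s[OF in_n(1)] s[OF in_n(2)]]
            by (auto simp: hurwitz_move_def fun_eq_iff g_def W'_def 2 F_def)
          have "g W' ?s \<in> ?O"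
          proof (rule IH_swap[OF i(1) W'_def refl])
            show "tuple_prod F n (g W' ?s) = tuple_prod F n (g W s)"
              using F.tuple_prod_hurwitz_move[OF i(1) Ws] unfolding move .
          qed (use W[OF in_n(2)] p in \<open>auto simp: 2\<close>)
          then show ?thesis
            using F.hurwitz_move_orbit_iff[OF i(1) Ws tS] move by simp
        qed
      next
        case nc: False
        \<comment> \<open>Nothing can be shortened any more, so the letter count against the
          positive word of \<open>t\<close> decides.\<close>
        define L where "L = map (\<lambda>i. (W i, s i)) [1..<n + 1]"
        define ss where "ss = map \<sigma> [1..<n + 1]"
        have "L = map (Pair []) ss"
        proof (rule positive_product_no_collision)
          show "reduced (conj_word (fst a) (snd a))" if "a \<in> set L" for a
            using that red by (auto simp: L_def)
          show "successively no_collision L"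
            using nc by (auto simp: successively_conv_nth L_def simp del: upt_Suc)
          \<comment> \<open>Reduced conjugates coincide with their words and a positive word is its
            own normal form, so \<open>prod\<close> becomes an equation with the word
            \<open>ss\<close>.\<close>
          have "map (g W s) [1..<n + 1] = map (\<lambda>a. conj_word (fst a) (snd a)) L"
            using red by (auto simp: L_def g_def conj_elt_def intro!: foldr_cancel_cons_Nil)
          moreover have "concat (map t [1..<n + 1]) = map (\<lambda>s. (s, True)) ss"
          proof -
            have "map t [1..<n + 1] = map (\<lambda>i. [(\<sigma> i, True)]) [1..<n + 1]"
              by (auto simp: t free_gen_def)
            then show ?thesis
              unfolding ss_def by (simp only: concat_map_singleton map_map comp_def)
          qed
          moreover have "reduced (map (\<lambda>s. (s, True)) zs)" for zs :: "nat list"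
            by (induction zs) (auto simp: reduced_Cons hd_map flip_def)
          ultimately show "foldr cancel_cons (concat (map (\<lambda>a. conj_word (fst a) (snd a)) L)) [] =
              map (\<lambda>s. (s, True)) ss"
            using prod unfolding F_def tuple_prod_free_group by (simp only: foldr_cancel_cons_Nil)
          show "length ss = length L" by (simp add: ss_def L_def)
        qed
        then have "W i = [] \<and> s i = \<sigma> i" if "i \<in> {1..n}" for i
          using that by (simp add: L_def ss_def del: upt_Suc)
        then have "g W s = t"
          by (auto simp: t g_def fun_eq_iff conj_elt_def conj_word_def free_gen_def cancel_cons_def)
        moreover have "t \<in> ?O"
          using group_action.orbit_refl[OF F.group_action_hurwitz tS] .
        ultimately show ?thesis by simp
      qed
    qed
  qed

  \<comment> \<open>Every tuple with the right classes and product is in the orbit\<close>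
  have "T \<subseteq> orbit (braid_group n) (hurwitz_action F n) t"
  proof
    fix h assume "h \<in> T"
    then obtain \<tau> where \<tau>: "\<tau> permutes {1..n}" "h \<in> (\<Pi>\<^sub>E i\<in>{1..n}. conjugacy_class F (t (\<tau> i)))"
        and prod: "tuple_prod F n h = tuple_prod F n t"
      by (auto simp: T_def)
    define s where "s = \<sigma> \<circ> \<tau>"
    have \<tau>_in: "\<tau> i \<in> {1..n}" if "i \<in> {1..n}" for i
      using that permutes_in_image[OF \<tau>(1)] by simp
    have "\<exists>w. set w \<subseteq> X \<times> UNIV \<and> h i = conj_elt w (s i)" if i: "i \<in> {1..n}" for i
    proof -
      have "h i \<in> conjugacy_class F (free_gen (s i))"
        using PiE_mem[OF \<tau>(2) i] \<sigma>(2)[OF \<tau>_in[OF i]] by (simp add: s_def)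
      then obtain c where c: "c \<in> carrier F" "h i = c \<otimes>\<^bsub>F\<^esub> free_gen (s i) \<otimes>\<^bsub>F\<^esub> inv\<^bsub>F\<^esub> c"
        by (auto simp: conjugacy_class_def)
      \<comment> \<open>The inverse appears because \<open>conjugacy_class\<close> uses
        \<open>c x c^-1\<close> and \<open>conj_elt\<close> uses \<open>w^-1 x w\<close>.\<close>
      define w where "w = inv\<^bsub>F\<^esub> c"
      have wc: "w \<in> carrier F" using c by (simp add: w_def)
      then have w: "set w \<subseteq> X \<times> UNIV" "foldr cancel_cons w [] = w"
        by (auto simp: F_def free_group_def foldr_cancel_cons_Nil)
      have "free_gen (s i) \<in> carrier F"
        unfolding F_def s_def using \<sigma>(1)[OF \<tau>_in[OF i]] by (intro free_gen_closed) simp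
      then have "h i = conj_elt w (s i)"
        using conj_elt_eq[OF w(1), of "s i", folded F_def] c wc
        by (simp add: w(2)) (simp add: w_def F.m_assoc)
      then show ?thesis using w by blast
    qed
    then obtain W where W: "\<And>i. i \<in> {1..n} \<Longrightarrow> set (W i) \<subseteq> X \<times> UNIV"
        "\<And>i. i \<in> {1..n} \<Longrightarrow> h i = conj_elt (W i) (s i)" by metis
    have "h = g W s"
      using W(2) \<tau>(2) by (auto simp: g_def fun_eq_iff PiE_def extensional_def)
    moreover have "s i \<in> X" if "i \<in> {1..n}" for i
      using \<sigma>(1)[OF \<tau>_in[OF that]] by (simp add: s_def)
    ultimately show "h \<in> orbit (braid_group n) (hurwitz_action F n) t"
      using descent[of W s] W(1) prod by simp
  qed
  with sub show ?thesis by (simp add: T_def F_def X_def)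
qed

end
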